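(* Let $q$ be a complex number with $|q|<1$. Then $$\sum_{k=0}^{\infty}q^{\binom{k+1}{2}}\frac{(q;q)_{k}}{(q^3;q^2)_{k}}\sum_{i=1}^{k}\frac{q^{i}}{[i]^2}=\frac{(q^2;q^2)_{\infty}^2}{(q,q^3;q^2)_{\infty}}\sum_{j=1}^{\infty}\frac{q^{2j}}{[2j]^2}.$$
   Context: For complex $x$ and $p$ with $|p|<1$, the $q$-shifted factorials with base $p$ are $(x;p)_{\infty}=\prod_{i=0}^{\infty}(1-xp^i)$ and, for an integer $n\ge 0$, $(x;p)_n=(x;p)_\infty/(xp^n;p)_\infty$, i.e. $(x;p)_n=\prod_{i=0}^{n-1}(1-xp^i)$. The compact notation $(x_1,\dots,x_r;p)_m=(x_1;p)_m\cdots(x_r;p)_m$ is used for $m$ a nonnegative integer or $\infty$. A power such as $(x;p)_m^2$ means $((x;p)_m)^2$. The $q$-integer is $[n]=1+q+\cdots+q^{n-1}$. Empty sums are $0$. *)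

theory Defs
  imports "HOL-Analysis.Analysis"
begin

definition qpoch_inf :: "complex \<Rightarrow> complex \<Rightarrow> complex" where
  "qpoch_inf x p = (\<Prod>i. 1 - x * p ^ i)"

definition qpoch :: "complex \<Rightarrow> complex \<Rightarrow> nat \<Rightarrow> complex" where
  "qpoch x p n = (\<Prod>i<n. 1 - x * p ^ i)"

definition qint :: "complex \<Rightarrow> nat \<Rightarrow> complex" where
  "qint q n = (\<Sum>i<n. q ^ i)"

text \<open>For \<open>|p| < 1\<close> the infinite product converges for every \<open>x\<close>, so
  \<^const>\<open>qpoch_inf\<close> denotes its actual value (which is 0 if some factor vanishes),
  and \<^const>\<open>qpoch\<close> satisfies the quotient description \<open>(x;p)_n = (x;p)_inf / (x p^n;p)_inf\<close>
  whenever the denominator is nonzero.\<close>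

lemma convergent_qpoch_inf:
  fixes x p :: complex
  assumes "norm p < 1"
  shows "convergent_prod (\<lambda>i. 1 - x * p ^ i)"
proof -
  have "summable (\<lambda>i. norm (x * p ^ i))"
    using assms by (auto simp: norm_mult norm_power intro!: summable_mult summable_geometric)
  then have "abs_convergent_prod (\<lambda>i. 1 - x * p ^ i)"
    by (simp add: abs_convergent_prod_conv_summable)
  then show ?thesis
    by (rule abs_convergent_prod_imp_convergent_prod)
qed

lemma qpoch_inf_split:
  assumes "norm p < 1"
  shows "qpoch_inf x p = qpoch x p n * qpoch_inf (x * p ^ n) p"
  using has_prod_unique[OF has_prod_ignore_initial_segment'[OF convergent_qpoch_inf[OF assms]], of x n]
  by (simp add: qpoch_inf_def qpoch_def power_add mult_ac)

end

theory Submission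
  imports Defs
begin

text \<open>
  Andrews' \<open>q\<close>-analogue of Gauss's second theorem states
  \[ \sum_k \frac{(a,b;q)_k}{(q;q)_k (abq;q^2)_k} q^{k(k+1)/2}
     = \frac{(aq,bq;q^2)_\infty}{(q,abq;q^2)_\infty}. \]
  A telescoping contiguous relation shows that both sides change by the same factor under
  \<open>a \<mapsto> a q\<^sup>2\<close>; iterating it sends \<open>a\<close> and then, by symmetry, \<open>b\<close> to \<open>0\<close>, and the trivial
  case \<open>b = 1\<close> fixes the remaining constant.
  For \<open>a = q x\<close>, \<open>b = q / x\<close> both sides depend only on \<open>t = x + 1 / x - 2\<close>, since
  \<open>(1 - r x) (1 - r / x) = (1 - r)\<^sup>2 - t r\<close>. The theorem is the equality of the coefficients
  of \<open>t\<close>, multiplied by \<open>- (1 - q)\<^sup>2\<close>.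
\<close>

section \<open>Bounds and limits\<close>

text \<open>Dominated convergence for series: the majorant \<open>M\<close> does not depend on
  \<open>n\<close>, so the limit may be taken termwise. It serves twice: for \<open>a\<close>
  tending to 0 in Gauss's sum and for \<open>t\<close> tending to 0 in the coefficient
  comparison.\<close>

lemma tannery_sequence:
  fixes a :: "nat \<Rightarrow> nat \<Rightarrow> 'a :: {real_normed_algebra, banach}"
  assumes "\<And>k. a k \<longlonglongrightarrow> b k" "\<And>k n. norm (a k n) \<le> M k" "summable M"
  shows "summable b" "(\<lambda>n. \<Sum>k. a k n) \<longlonglongrightarrow> (\<Sum>k. b k)"
proof -
  have "eventually (\<lambda>(k,n). norm (a k n) \<le> M k) (at_top \<times>\<^sub>F sequentially)"
    using assms(2) by (intro always_eventually) auto
  from tannerys_theorem[OF assms(1) this assms(3)]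
  show "summable b" "(\<lambda>n. \<Sum>k. a k n) \<longlonglongrightarrow> (\<Sum>k. b k)"
    by (auto intro: summable_norm_cancel)
qed

text \<open>Follows from 1 + u \<le> exp u. The point is that the bound is the same for all
  \<open>n\<close>.\<close>

lemma norm_prod_one_minus_le:
  fixes f :: "nat \<Rightarrow> 'a :: {real_normed_field, banach}"
  assumes "summable (\<lambda>i. norm (f i))"
  shows "norm (\<Prod>i<n. 1 - f i) \<le> exp (\<Sum>i. norm (f i))"
proof -
  have "norm (\<Prod>i<n. 1 - f i) \<le> (\<Prod>i<n. 1 + norm (f i))"
    unfolding prod_norm[symmetric]
    using norm_triangle_ineq4[of 1 "f _"] by (intro prod_mono) auto
  also have "\<dots> \<le> exp (\<Sum>i<n. norm (f i))"
    by (intro prod_le_exp_sum) auto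
  also have "\<dots> \<le> exp (\<Sum>i. norm (f i))"
    using assms by (auto intro: sum_le_suminf)
  finally show ?thesis .
qed

section \<open>Elementary properties, limits and bounds of q-shifted factorials\<close>

lemma qpoch_LIMSEQ:
  assumes "norm p < 1"
  shows "qpoch x p \<longlonglongrightarrow> qpoch_inf x p"
  unfolding qpoch_def [abs_def] qpoch_inf_def
  by (intro has_prod_imp_tendsto' convergent_prod_has_prod convergent_qpoch_inf assms)

lemma qpoch_inf_nonzero:
  assumes "norm p < 1" "\<And>i. x * p ^ i \<noteq> 1"
  shows "qpoch_inf x p \<noteq> 0"
proof -
  have "(\<lambda>i. 1 - x * p ^ i) has_prod qpoch_inf x p"
    unfolding qpoch_inf_def by (intro convergent_prod_has_prod convergent_qpoch_inf assms)
  then show ?thesis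
    using assms(2) by (auto simp: has_prod_eq_0_iff)
qed

lemma qpoch_nonzero:
  assumes "\<And>i. x * p ^ i \<noteq> 1"
  shows "qpoch x p n \<noteq> 0"
  using assms by (auto simp: qpoch_def)

lemma qpoch_0 [simp]: "qpoch x p 0 = 1"
  and qpoch_Suc: "qpoch x p (Suc n) = qpoch x p n * (1 - x * p ^ n)"
  and qpoch_zero_left [simp]: "qpoch 0 p n = 1"
  by (simp_all add: qpoch_def)

lemma qpoch_add: "qpoch x p (m + n) = qpoch x p m * qpoch (x * p ^ m) p n"
  by (induction n) (simp_all add: qpoch_Suc power_add mult_ac)

lemma qpoch_Suc_left: "qpoch x p (Suc n) = (1 - x) * qpoch (x * p) p n"
  using qpoch_add[of x p 1 n] by (simp add: qpoch_Suc)

lemma qpoch_inf_zero_left [simp]: "qpoch_inf 0 p = 1"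
  by (simp add: qpoch_inf_def)

lemma norm_qpoch_le:
  assumes "norm p < 1"
  shows "norm (qpoch x p n) \<le> exp (norm x / (1 - norm p))"
proof -
  have "summable (\<lambda>i. norm (x * p ^ i))"
    using assms by (auto simp: norm_mult norm_power intro!: summable_mult summable_geometric)
  moreover have "(\<Sum>i. norm (x * p ^ i)) = norm x / (1 - norm p)"
    using assms by (simp add: norm_mult norm_power suminf_mult suminf_geometric)
  ultimately show ?thesis
    using norm_prod_one_minus_le[of "\<lambda>i. x * p ^ i" n] by (simp add: qpoch_def)
qed

text \<open>A convergent infinite product without zero factors has a nonzero limit, so the
  reciprocals converge as well and are therefore bounded.\<close>

lemma norm_inverse_qpoch_bounded:
  assumes "norm p < 1" "\<And>i. x * p ^ i \<noteq> 1"
  obtains K where "K > 0" "\<And>n. norm (inverse (qpoch x p n)) \<le> K"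
proof -
  have "(\<lambda>n. inverse (qpoch x p n)) \<longlonglongrightarrow> inverse (qpoch_inf x p)"
    by (intro tendsto_inverse qpoch_LIMSEQ qpoch_inf_nonzero assms)
  then have "Bseq (\<lambda>n. inverse (qpoch x p n))"
    by (intro convergent_imp_Bseq convergentI)
  then show thesis
    by (metis BseqE that)
qed

lemma power_ne_one:
  fixes q :: complex
  assumes "norm q < 1" "n > 0"
  shows "q ^ n \<noteq> 1"
proof
  assume "q ^ n = 1"
  then have "norm q ^ n = 1"
    by (metis norm_one norm_power)
  moreover have "norm q ^ n < 1"
    using assms by (simp add: power_less_one_iff)
  ultimately show False by simp
qed

lemma norm_power_sq_less_one:
  fixes q :: complex
  assumes "norm q < 1"
  shows "norm (q ^ 2) < 1"
  using assms by (simp add: norm_power power_less_one_iff)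

text \<open>The exponent k(k+1)/2 is at least k; this crude estimate already gives a geometric
  majorant for every series below.\<close>

lemma norm_power_triangular_le:
  fixes q :: complex
  assumes "norm q < 1"
  shows "norm (q ^ (Suc k choose 2)) \<le> norm q ^ k"
proof -
  have "k \<le> Suc k choose 2"
    by (cases k) (simp_all add: numeral_2_eq_2)
  with assms show ?thesis
    unfolding norm_power by (intro power_decreasing) auto
qed

section \<open>The q-analogue of Gauss's second summation theorem\<close>

definition gauss2_term :: "complex \<Rightarrow> complex \<Rightarrow> complex \<Rightarrow> nat \<Rightarrow> complex" where
  "gauss2_term q a b k = qpoch a q k * qpoch b q k * q ^ (Suc k choose 2)
     / (qpoch q q k * qpoch (a * b * q) (q ^ 2) k)"

lemma gauss2_term_commute: "gauss2_term q a b = gauss2_term q b a"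
  by (simp add: gauss2_term_def fun_eq_iff mult_ac)

text \<open>The closed form of the partial sums is the telescoping certificate found by
  \<open>q\<close>-Zeilberger's method; it tends to \<open>0\<close>.\<close>

lemma gauss2_contiguous_partial_sum:
  assumes q: "norm q < 1" and ab: "\<And>i. a * b * q * (q ^ 2) ^ i \<noteq> 1"
  shows "(\<Sum>k\<le>n. (1 - a * b * q) * gauss2_term q a b k - (1 - a * q) * gauss2_term q (a * q ^ 2) b k)
    = a * qpoch (a * q) q n * qpoch b q (Suc n) * q ^ (Suc (Suc n) choose 2)
        / (qpoch q q n * qpoch (a * b * q ^ 3) (q ^ 2) n)"
proof (induction n)
  case 0
  have "a * b * q \<noteq> 1" using ab[of 0] by simp
  then show ?case
    by (simp add: gauss2_term_def qpoch_Suc numeral_2_eq_2 algebra_simps)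
next
  case (Suc n)
  \<comment> \<open>Naming the shared factorials and powers makes the induction step a rational
    identity in \<open>a\<close>, \<open>b\<close>, \<open>q\<close> and \<open>Q\<close>.\<close>
  define A where "A = qpoch (a * q) q n"
  define B where "B = qpoch b q n"
  define D where "D = qpoch q q n"
  define E where "E = qpoch (a * b * q ^ 3) (q ^ 2) n"
  define T where "T = q ^ (Suc n choose 2)"
  define Q where "Q = q ^ n"
  have nz: "D \<noteq> 0" "E \<noteq> 0" "1 - q * Q \<noteq> 0" "1 - a * b * q \<noteq> 0" "1 - a * b * q ^ 3 * Q ^ 2 \<noteq> 0"
  proof -
    have *: "q ^ Suc i \<noteq> 1" for i using power_ne_one[OF q, of "Suc i"] by simp
    show "D \<noteq> 0" unfolding D_def using * by (intro qpoch_nonzero) simp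
    have **: "a * b * q ^ 3 * (q ^ 2) ^ i \<noteq> 1" for i
      using ab[of "Suc i"] by (simp add: power2_eq_square power3_eq_cube mult_ac)
    then show "E \<noteq> 0" unfolding E_def by (intro qpoch_nonzero)
    show "1 - q * Q \<noteq> 0" using *[of n] by (simp add: Q_def)
    show "1 - a * b * q \<noteq> 0" using ab[of 0] by simp
    show "1 - a * b * q ^ 3 * Q ^ 2 \<noteq> 0"
      using **[of n] by (simp add: Q_def power_mult[symmetric] mult.commute)
  qed
  have T2: "q ^ (Suc (Suc n) choose 2) = T * (q * Q)" "q ^ (Suc (Suc (Suc n)) choose 2) = T * (q * Q) * (q ^ 2 * Q)"
    by (simp_all add: T_def Q_def numeral_2_eq_2 power_add mult_ac)
  have t1: "gauss2_term q a b (Suc n) = (1 - a) * A * (B * (1 - b * Q)) * (T * (q * Q))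
      / (D * (1 - q * Q) * ((1 - a * b * q) * E))"
    unfolding gauss2_term_def T2 qpoch_Suc_left[of a] qpoch_Suc_left[of "a * b * q"]
      qpoch_Suc[of b] qpoch_Suc[of q]
    by (simp add: A_def B_def D_def E_def Q_def power2_eq_square power3_eq_cube mult_ac)
  \<comment> \<open>The prefactor 1 - aq completes the shifted factorial to one starting at aq, so
    that \<open>A\<close> can be split off here too.\<close>
  have A2: "(1 - a * q) * qpoch (a * q ^ 2) q (Suc n) = A * (1 - a * q * Q) * (1 - a * q ^ 2 * Q)"
  proof -
    have "(1 - a * q) * qpoch (a * q ^ 2) q (Suc n) = qpoch (a * q) q (Suc (Suc n))"
      by (simp add: qpoch_Suc_left[of "a * q"] power2_eq_square mult.assoc)
    also have "\<dots> = A * (1 - a * q * Q) * (1 - a * q ^ 2 * Q)"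
      by (simp add: A_def Q_def qpoch_Suc[of "a * q"] power2_eq_square mult_ac)
    finally show ?thesis .
  qed
  have E2: "qpoch (a * q ^ 2 * b * q) (q ^ 2) (Suc n) = E * (1 - a * b * q ^ 3 * Q ^ 2)"
    by (simp add: E_def Q_def qpoch_Suc power2_eq_square power3_eq_cube mult_ac power_mult_distrib)
  have t2: "(1 - a * q) * gauss2_term q (a * q ^ 2) b (Suc n)
      = A * (1 - a * q * Q) * (1 - a * q ^ 2 * Q) * (B * (1 - b * Q)) * (T * (q * Q))
      / (D * (1 - q * Q) * (E * (1 - a * b * q ^ 3 * Q ^ 2)))"
    unfolding A2[symmetric] gauss2_term_def T2 E2
    by (simp add: qpoch_Suc[of b] qpoch_Suc[of q] B_def D_def Q_def mult_ac)
  have g1: "a * qpoch (a * q) q n * qpoch b q (Suc n) * q ^ (Suc (Suc n) choose 2)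
        / (qpoch q q n * qpoch (a * b * q ^ 3) (q ^ 2) n)
      = a * A * (B * (1 - b * Q)) * (T * (q * Q)) / (D * E)"
    by (simp only: T2) (simp add: A_def B_def D_def E_def Q_def qpoch_Suc)
  have g2: "a * qpoch (a * q) q (Suc n) * qpoch b q (Suc (Suc n)) * q ^ (Suc (Suc (Suc n)) choose 2)
        / (qpoch q q (Suc n) * qpoch (a * b * q ^ 3) (q ^ 2) (Suc n))
      = a * (A * (1 - a * q * Q)) * (B * (1 - b * Q) * (1 - b * q * Q)) * (T * (q * Q) * (q ^ 2 * Q))
        / (D * (1 - q * Q) * (E * (1 - a * b * q ^ 3 * Q ^ 2)))"
    by (simp only: T2) (simp add: A_def B_def D_def E_def Q_def qpoch_Suc mult_ac
        power2_eq_square power_mult_distrib)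
  \<comment> \<open>\<open>S\<close> is the common factor of the old certificate and both new
    summands; what remains is free of factorials.\<close>
  define S where "S = A * B * (1 - b * Q) * (T * (q * Q)) / (D * E)"
  have "a * A * (B * (1 - b * Q)) * (T * (q * Q)) / (D * E)
     + ((1 - a * b * q) * gauss2_term q a b (Suc n) - (1 - a * q) * gauss2_term q (a * q ^ 2) b (Suc n))
     = S * (a + (1 - a) / (1 - q * Q)
         - (1 - a * q * Q) * (1 - a * q ^ 2 * Q) / ((1 - q * Q) * (1 - a * b * q ^ 3 * Q ^ 2)))"
  proof -
    have "a * A * (B * (1 - b * Q)) * (T * (q * Q)) / (D * E) = S * a"
      by (simp add: S_def)
    moreover have "(1 - a * b * q) * gauss2_term q a b (Suc n) = S * ((1 - a) / (1 - q * Q))"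
      unfolding t1 S_def using nz(4) by (simp add: mult_ac)
    moreover have "(1 - a * q) * gauss2_term q (a * q ^ 2) b (Suc n)
        = S * ((1 - a * q * Q) * (1 - a * q ^ 2 * Q) / ((1 - q * Q) * (1 - a * b * q ^ 3 * Q ^ 2)))"
      unfolding t2 S_def by (simp add: mult_ac)
    ultimately show ?thesis
      by (simp only: distrib_left right_diff_distrib add_diff_eq)
  qed
  also have "a + (1 - a) / (1 - q * Q)
         - (1 - a * q * Q) * (1 - a * q ^ 2 * Q) / ((1 - q * Q) * (1 - a * b * q ^ 3 * Q ^ 2))
      = a * (1 - a * q * Q) * (1 - b * q * Q) * (q ^ 2 * Q) / ((1 - q * Q) * (1 - a * b * q ^ 3 * Q ^ 2))"
  \<comment> \<open>Over the common denominator the claim becomes the polynomial identity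
    \<open>num\<close>.\<close>
  proof -
    have num: "a * ((1 - q * Q) * (1 - a * b * q ^ 3 * Q ^ 2)) + (1 - a) * (1 - a * b * q ^ 3 * Q ^ 2)
        - (1 - a * q * Q) * (1 - a * q ^ 2 * Q) = a * (1 - a * q * Q) * (1 - b * q * Q) * (q ^ 2 * Q)"
      by (simp add: algebra_simps power2_eq_square power3_eq_cube)
    have combine: "a + (1 - a) / X - N / (X * Y) = (a * (X * Y) + (1 - a) * Y - N) / (X * Y)"
      if "X \<noteq> 0" "Y \<noteq> 0" for X Y N
      using that by (simp add: add_divide_distrib diff_divide_distrib)
    show ?thesis
      unfolding combine[OF nz(3) nz(5)] num ..
  qed
  also have "S * \<dots> = a * (A * (1 - a * q * Q)) * (B * (1 - b * Q) * (1 - b * q * Q)) * (T * (q * Q) * (q ^ 2 * Q))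
        / (D * (1 - q * Q) * (E * (1 - a * b * q ^ 3 * Q ^ 2)))"
    unfolding S_def by (simp only: times_divide_times_eq mult_ac)
  finally show ?case
    unfolding sum.atMost_Suc Suc.IH g1 g2 .
qed

text \<open>One \<open>K\<close> for all shifts \<open>n\<close> is what dominated convergence along
  a q^(2n) requires; the case n = 0 yields summability.\<close>

lemma norm_gauss2_term_bounded:
  assumes q: "norm q < 1" and ab: "\<And>i. a * b * q * (q ^ 2) ^ i \<noteq> 1"
  obtains K where "\<And>n k. norm (gauss2_term q (a * (q ^ 2) ^ n) b k) \<le> K * norm q ^ k"
proof -
  note q2 = norm_power_sq_less_one[OF q]
  have "q * q ^ i \<noteq> 1" for i using power_ne_one[OF q, of "Suc i"] by simp
  then obtain K1 where K1: "K1 > 0" "\<And>n. norm (inverse (qpoch q q n)) \<le> K1"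
    using norm_inverse_qpoch_bounded[OF q] by metis
  obtain K2 where K2: "K2 > 0" "\<And>n. norm (inverse (qpoch (a * b * q) (q ^ 2) n)) \<le> K2"
    using norm_inverse_qpoch_bounded[OF q2 ab] by metis
  define E where "E x p = exp (norm x / (1 - norm p))" for x p :: complex
  define K where "K = E a q * E b q * (K1 * (E (a * b * q) (q ^ 2) * K2))"
  have "norm (gauss2_term q (a * (q ^ 2) ^ n) b k) \<le> K * norm q ^ k" for n k
  proof -
    have "norm (qpoch (a * (q ^ 2) ^ n) q k) \<le> E (a * (q ^ 2) ^ n) q"
      unfolding E_def by (rule norm_qpoch_le[OF q])
    also have "\<dots> \<le> E a q"
      using q by (auto simp: E_def norm_mult norm_power intro!: divide_right_mono mult_left_le power_le_one)
    finally have 1: "norm (qpoch (a * (q ^ 2) ^ n) q k) \<le> E a q" .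
    \<comment> \<open>The denominator depends on \<open>n\<close> as well. Writing the shifted
      factorial as a quotient of two factorials starting at abq lets the single bound
      \<open>K2\<close> on reciprocals cover every \<open>n\<close>.\<close>
    have 2: "norm (qpoch b q k) \<le> E b q"
      unfolding E_def by (rule norm_qpoch_le[OF q])
    have "inverse (qpoch (a * b * q * (q ^ 2) ^ n) (q ^ 2) k)
        = qpoch (a * b * q) (q ^ 2) n * inverse (qpoch (a * b * q) (q ^ 2) (n + k))"
      using qpoch_nonzero[of "a * b * q" "q ^ 2", OF ab] by (simp add: qpoch_add)
    also have "norm \<dots> \<le> E (a * b * q) (q ^ 2) * K2"
      unfolding norm_mult by (intro mult_mono K2 norm_qpoch_le[OF q2, folded E_def]) (auto simp: E_def)
    finally have 3: "norm (inverse (qpoch (a * b * q * (q ^ 2) ^ n) (q ^ 2) k)) \<le> E (a * b * q) (q ^ 2) * K2" .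
    have "norm (gauss2_term q (a * (q ^ 2) ^ n) b k) =
        norm (qpoch (a * (q ^ 2) ^ n) q k) * norm (qpoch b q k) * (norm (inverse (qpoch q q k))
        * norm (inverse (qpoch (a * b * q * (q ^ 2) ^ n) (q ^ 2) k))) * norm (q ^ (Suc k choose 2))"
      by (simp add: gauss2_term_def norm_mult norm_divide norm_inverse divide_simps mult_ac)
    also have "\<dots> \<le> K * norm q ^ k"
      unfolding K_def
      by (intro mult_mono 1 2 3 K1 norm_power_triangular_le[OF q] mult_nonneg_nonneg)
        (use K1 K2 in \<open>auto simp: E_def\<close>)
    finally show ?thesis .
  qed
  then show thesis by (rule that)
qed

lemma summable_gauss2_term:
  assumes "norm q < 1" "\<And>i. a * b * q * (q ^ 2) ^ i \<noteq> 1"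
  shows "summable (gauss2_term q a b)"
proof -
  obtain K where K: "\<And>n k. norm (gauss2_term q (a * (q ^ 2) ^ n) b k) \<le> K * norm q ^ k"
    using norm_gauss2_term_bounded[OF assms] by metis
  show ?thesis
    by (rule summable_comparison_test'[of "\<lambda>k. K * norm q ^ k"])
      (use K[of 0] assms in \<open>auto intro!: summable_mult summable_geometric\<close>)
qed

text \<open>The partial sums telescope to the certificate. Its power of \<open>q\<close> tends to 0,
  while its factorials converge, those in the denominator to nonzero limits.\<close>

lemma gauss2_contiguous:
  assumes q: "norm q < 1" and ab: "\<And>i. a * b * q * (q ^ 2) ^ i \<noteq> 1"
  shows "(1 - a * b * q) * (\<Sum>k. gauss2_term q a b k) = (1 - a * q) * (\<Sum>k. gauss2_term q (a * q ^ 2) b k)"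
proof -
  note q2 = norm_power_sq_less_one[OF q]
  have ab': "a * q ^ 2 * b * q * (q ^ 2) ^ i \<noteq> 1" for i
    using ab[of "Suc i"] by (simp add: mult_ac)
  have ab3: "a * b * q ^ 3 * (q ^ 2) ^ i \<noteq> 1" for i
    using ab'[of i] by (simp add: power2_eq_square power3_eq_cube mult_ac)
  have qq: "q * q ^ i \<noteq> 1" for i using power_ne_one[OF q, of "Suc i"] by simp
  note s = summable_gauss2_term[OF q]
  have "(\<lambda>k. (1 - a * b * q) * gauss2_term q a b k - (1 - a * q) * gauss2_term q (a * q ^ 2) b k)
     sums ((1 - a * b * q) * (\<Sum>k. gauss2_term q a b k) - (1 - a * q) * (\<Sum>k. gauss2_term q (a * q ^ 2) b k))"
    by (intro sums_diff sums_mult summable_sums s ab ab')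
  then have "(\<lambda>n. a * qpoch (a * q) q n * qpoch b q (Suc n) * q ^ (Suc (Suc n) choose 2)
        / (qpoch q q n * qpoch (a * b * q ^ 3) (q ^ 2) n))
     \<longlonglongrightarrow> ((1 - a * b * q) * (\<Sum>k. gauss2_term q a b k) - (1 - a * q) * (\<Sum>k. gauss2_term q (a * q ^ 2) b k))"
    unfolding sums_def_le gauss2_contiguous_partial_sum[OF q ab] .
  moreover have "(\<lambda>n. a * qpoch (a * q) q n * qpoch b q (Suc n) * q ^ (Suc (Suc n) choose 2)
        / (qpoch q q n * qpoch (a * b * q ^ 3) (q ^ 2) n)) \<longlonglongrightarrow>
      a * qpoch_inf (a * q) q * qpoch_inf b q * 0 / (qpoch_inf q q * qpoch_inf (a * b * q ^ 3) (q ^ 2))"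
  proof (intro tendsto_intros qpoch_LIMSEQ q q2 filterlim_compose[OF qpoch_LIMSEQ[OF q] filterlim_Suc])
    show "(\<lambda>n. q ^ (Suc (Suc n) choose 2)) \<longlonglongrightarrow> 0"
    proof (rule Lim_null_comparison)
      show "\<forall>\<^sub>F n in sequentially. norm (q ^ (Suc (Suc n) choose 2)) \<le> norm q ^ Suc n"
        by (intro always_eventually allI norm_power_triangular_le q)
      show "(\<lambda>n. norm q ^ Suc n) \<longlonglongrightarrow> 0"
        using q by (intro filterlim_compose[OF LIMSEQ_power_zero filterlim_Suc]) auto
    qed
    show "qpoch_inf q q * qpoch_inf (a * b * q ^ 3) (q ^ 2) \<noteq> 0"
      using qpoch_inf_nonzero[OF q qq] qpoch_inf_nonzero[OF q2 ab3] by simp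
  qed
  ultimately have "(1 - a * b * q) * (\<Sum>k. gauss2_term q a b k) - (1 - a * q) * (\<Sum>k. gauss2_term q (a * q ^ 2) b k)
      = a * qpoch_inf (a * q) q * qpoch_inf b q * 0 / (qpoch_inf q q * qpoch_inf (a * b * q ^ 3) (q ^ 2))"
    by (rule LIMSEQ_unique)
  then show ?thesis by simp
qed

lemma gauss2_iterate:
  assumes q: "norm q < 1" and ab: "\<And>i. a * b * q * (q ^ 2) ^ i \<noteq> 1"
  shows "qpoch (a * b * q) (q ^ 2) n * (\<Sum>k. gauss2_term q a b k)
    = qpoch (a * q) (q ^ 2) n * (\<Sum>k. gauss2_term q (a * (q ^ 2) ^ n) b k)"
proof (induction n)
  case (Suc n)
  let ?a = "a * (q ^ 2) ^ n"
  have "?a * b * q * (q ^ 2) ^ i \<noteq> 1" for i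
    using ab[of "n + i"] by (simp add: power_add mult_ac)
  from gauss2_contiguous[OF q this]
  have step: "(1 - a * b * q * (q ^ 2) ^ n) * (\<Sum>k. gauss2_term q ?a b k)
      = (1 - a * q * (q ^ 2) ^ n) * (\<Sum>k. gauss2_term q (a * (q ^ 2) ^ Suc n) b k)"
    by (simp add: mult_ac)
  have "qpoch (a * b * q) (q ^ 2) (Suc n) * (\<Sum>k. gauss2_term q a b k)
      = (1 - a * b * q * (q ^ 2) ^ n) * (qpoch (a * b * q) (q ^ 2) n * (\<Sum>k. gauss2_term q a b k))"
    by (simp only: qpoch_Suc mult_ac)
  also have "\<dots> = qpoch (a * q) (q ^ 2) n * ((1 - a * b * q * (q ^ 2) ^ n) * (\<Sum>k. gauss2_term q ?a b k))"
    unfolding Suc.IH by (rule mult.left_commute)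
  also have "\<dots> = qpoch (a * q) (q ^ 2) (Suc n) * (\<Sum>k. gauss2_term q (a * (q ^ 2) ^ Suc n) b k)"
    unfolding step by (simp only: qpoch_Suc mult.assoc)
  finally show ?case .
qed simp

text \<open>Let \<open>n\<close> tend to infinity in the iterated relation: the finite products
  become infinite ones, and the parameter a q^(2n) tends to 0 under the sum.\<close>

lemma gauss2_reduce:
  assumes q: "norm q < 1" and ab: "\<And>i. a * b * q * (q ^ 2) ^ i \<noteq> 1"
  shows "qpoch_inf (a * b * q) (q ^ 2) * (\<Sum>k. gauss2_term q a b k)
    = qpoch_inf (a * q) (q ^ 2) * (\<Sum>k. gauss2_term q 0 b k)"
proof -
  note q2 = norm_power_sq_less_one[OF q]
  obtain K where K: "\<And>n k. norm (gauss2_term q (a * (q ^ 2) ^ n) b k) \<le> K * norm q ^ k"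
    using norm_gauss2_term_bounded[OF q ab] by metis
  have qq: "q * q ^ i \<noteq> 1" for i using power_ne_one[OF q, of "Suc i"] by simp
  have lim: "(\<lambda>n. gauss2_term q (a * (q ^ 2) ^ n) b k) \<longlonglongrightarrow> gauss2_term q 0 b k" for k
  proof -
    have z: "(\<lambda>n. a * (q ^ 2) ^ n) \<longlonglongrightarrow> 0"
      using tendsto_mult[OF tendsto_const LIMSEQ_power_zero[OF q2]] by simp
    have *: "(\<lambda>n. qpoch (f n) p k) \<longlonglongrightarrow> qpoch 0 p k" if "f \<longlonglongrightarrow> 0" for f p
      unfolding qpoch_def by (intro tendsto_intros that)
    have "(\<lambda>n. a * (q ^ 2) ^ n * b * q) \<longlonglongrightarrow> 0 * b * q"
      by (intro tendsto_intros z)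
    then have "(\<lambda>n. a * (q ^ 2) ^ n * b * q) \<longlonglongrightarrow> 0" by simp
    note * = *[OF z, of q] *[OF this, of "q ^ 2"]
    have "(\<lambda>n. gauss2_term q (a * (q ^ 2) ^ n) b k) \<longlonglongrightarrow>
        qpoch 0 q k * qpoch b q k * q ^ (Suc k choose 2) / (qpoch q q k * qpoch 0 (q ^ 2) k)"
      unfolding gauss2_term_def
      by (intro tendsto_intros *) (use qpoch_nonzero[of q q k, OF qq] in auto)
    then show ?thesis by (simp add: gauss2_term_def)
  qed
  have "(\<lambda>n. \<Sum>k. gauss2_term q (a * (q ^ 2) ^ n) b k) \<longlonglongrightarrow> (\<Sum>k. gauss2_term q 0 b k)"
    by (rule tannery_sequence[OF lim K]) (use q in \<open>auto intro!: summable_mult summable_geometric\<close>)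
  then have "(\<lambda>n. qpoch (a * q) (q ^ 2) n * (\<Sum>k. gauss2_term q (a * (q ^ 2) ^ n) b k))
      \<longlonglongrightarrow> qpoch_inf (a * q) (q ^ 2) * (\<Sum>k. gauss2_term q 0 b k)"
    by (intro tendsto_mult qpoch_LIMSEQ q2)
  moreover have "(\<lambda>n. qpoch (a * b * q) (q ^ 2) n * (\<Sum>k. gauss2_term q a b k))
      \<longlonglongrightarrow> qpoch_inf (a * b * q) (q ^ 2) * (\<Sum>k. gauss2_term q a b k)"
    by (intro tendsto_mult qpoch_LIMSEQ q2 tendsto_const)
  ultimately show ?thesis
    unfolding gauss2_iterate[OF q ab] by (rule LIMSEQ_unique[symmetric])
qed

theorem q_gauss2:
  assumes q: "norm q < 1" and ab: "\<And>i. a * b * q * (q ^ 2) ^ i \<noteq> 1"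
  shows "gauss2_term q a b sums
    (qpoch_inf (a * q) (q ^ 2) * qpoch_inf (b * q) (q ^ 2)
      / (qpoch_inf q (q ^ 2) * qpoch_inf (a * b * q) (q ^ 2)))"
proof -
  note q2 = norm_power_sq_less_one[OF q]
  define F where "F a b = (\<Sum>k. gauss2_term q a b k)" for a b
  \<comment> \<open>The reduction is applied to the parameters (c, 0), where the left-hand product
    is 1; symmetry turns \<open>F c 0\<close> into \<open>F 0 c\<close>.\<close>
  have F0: "F 0 c = qpoch_inf (c * q) (q ^ 2) * F 0 0" for c
    using gauss2_reduce[OF q, of c 0] by (simp add: F_def gauss2_term_commute[of q c 0])
  \<comment> \<open>For b = 1 the factor (1;q)_k vanishes as soon as k \<ge> 1. Comparison with
    \<open>F0\<close> at c = 1 determines \<open>F 0 0\<close> and also shows that (q;q^2)_inf is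
    nonzero.\<close>
  have "gauss2_term q 0 1 = (\<lambda>k. if k = 0 then 1 else 0)"
  proof
    show "gauss2_term q 0 1 k = (if k = 0 then 1 else 0)" for k
      by (cases k) (simp_all add: gauss2_term_def qpoch_Suc_left numeral_2_eq_2)
  qed
  then have "F 0 1 = 1"
    using sums_single[of 0 "\<lambda>_. 1 :: complex"] by (simp add: F_def sums_iff)
  then have F00: "qpoch_inf q (q ^ 2) * F 0 0 = 1"
    using F0[of 1] by simp
  have "qpoch_inf (a * b * q) (q ^ 2) * F a b = qpoch_inf (a * q) (q ^ 2) * F 0 b"
    unfolding F_def by (rule gauss2_reduce[OF q ab])
  also have "F 0 b = qpoch_inf (b * q) (q ^ 2) * F 0 0" by (rule F0)
  finally have "qpoch_inf q (q ^ 2) * qpoch_inf (a * b * q) (q ^ 2) * F a b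
      = qpoch_inf (a * q) (q ^ 2) * qpoch_inf (b * q) (q ^ 2) * (qpoch_inf q (q ^ 2) * F 0 0)"
    by (simp add: mult_ac)
  moreover have "qpoch_inf q (q ^ 2) \<noteq> 0" using F00 by auto
  moreover have "qpoch_inf (a * b * q) (q ^ 2) \<noteq> 0"
    by (rule qpoch_inf_nonzero[OF q2 ab])
  ultimately have "F a b = qpoch_inf (a * q) (q ^ 2) * qpoch_inf (b * q) (q ^ 2)
      / (qpoch_inf q (q ^ 2) * qpoch_inf (a * b * q) (q ^ 2))"
    unfolding F00 by (simp add: field_simps)
  moreover have "gauss2_term q a b sums F a b"
    unfolding F_def by (intro summable_sums summable_gauss2_term q ab)
  ultimately show ?thesis by simp
qed

section \<open>Comparison of linear coefficients\<close>

text \<open>Each summand, times \<open>t\<close>, is the drop between consecutive partial products.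
  The formula is exact, so 1 minus the product can be divided by \<open>t\<close> with no error
  term.\<close>

lemma prod_one_minus_eq:
  fixes c :: "nat \<Rightarrow> 'a :: comm_ring_1"
  shows "(\<Prod>i<n. 1 - t * c i) = 1 - t * (\<Sum>i<n. c i * (\<Prod>l<i. 1 - t * c l))"
  by (induction n) (simp_all add: algebra_simps)

lemma norm_weighted_prod_le:
  fixes c :: "nat \<Rightarrow> complex"
  assumes c: "summable (\<lambda>i. norm (c i))" and t: "norm t \<le> 1"
  shows "norm (c i * (\<Prod>l<i. 1 - t * c l)) \<le> exp (\<Sum>i. norm (c i)) * norm (c i)"
proof -
  have le: "norm (t * c l) \<le> norm (c l)" for l
    using t by (simp add: norm_mult mult_left_le_one_le)
  have s: "summable (\<lambda>l. norm (t * c l))"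
    by (rule summable_comparison_test'[OF c]) (use le in simp)
  have "norm (\<Prod>l<i. 1 - t * c l) \<le> exp (\<Sum>l. norm (t * c l))"
    by (rule norm_prod_one_minus_le[OF s])
  also have "\<dots> \<le> exp (\<Sum>i. norm (c i))"
    using suminf_le[OF le s c] by simp
  finally show ?thesis
    unfolding norm_mult mult.commute[of "norm (c i)"] by (intro mult_right_mono) auto
qed

text \<open>Subtract the identity at \<open>t m\<close> from the one at 0, divide by
  \<open>t m\<close>, and let \<open>m\<close> tend to infinity. The difference quotients are
  explicit sums with uniform majorants, so dominated convergence replaces differentiation under the
  sum.\<close>

lemma linear_coefficient_comparison:
  fixes A c d :: "nat \<Rightarrow> complex" and t P :: "nat \<Rightarrow> complex"
  assumes A: "summable (\<lambda>k. norm (A k))" and c: "summable (\<lambda>i. norm (c i))"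
    and d: "summable (\<lambda>i. norm (d i))"
    and t: "t \<longlonglongrightarrow> 0" "\<And>m. t m \<noteq> 0" "\<And>m. norm (t m) \<le> 1"
    and C: "A sums C"
    and P: "\<And>m. (\<lambda>n. \<Prod>i<n. 1 - t m * d i) \<longlonglongrightarrow> P m"
    and eq: "\<And>m. (\<lambda>k. A k * (\<Prod>i<k. 1 - t m * c i)) sums (C * P m)"
  shows "(\<lambda>k. A k * (\<Sum>i<k. c i)) sums (C * (\<Sum>i. d i))"
proof -
  \<comment> \<open>The summands of the difference quotient of the product over \<open>e\<close>;
    each tends to \<open>e i\<close> and is dominated by a multiple of
    \<open>norm (e i)\<close>.\<close>
  define W where "W e i m = e i * (\<Prod>l<i. 1 - t m * e l)" for e :: "nat \<Rightarrow> complex" and i m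
  have W_lim: "W e i \<longlonglongrightarrow> e i" for e i
  proof -
    have "W e i \<longlonglongrightarrow> e i * (\<Prod>l<i. 1 - 0 * e l)"
      unfolding W_def [abs_def] by (intro tendsto_intros t(1))
    then show ?thesis by simp
  qed
  have W_le: "norm (W e i m) \<le> exp (\<Sum>i. norm (e i)) * norm (e i)"
    if "summable (\<lambda>i. norm (e i))" for e i m
    unfolding W_def by (rule norm_weighted_prod_le[OF that t(3)])
  have prod: "(\<Prod>i<n. 1 - t m * e i) = 1 - t m * (\<Sum>i<n. W e i m)" for e n m
    unfolding W_def by (rule prod_one_minus_eq)

  have W_sum: "norm (\<Sum>i<k. W c i m) \<le> exp (\<Sum>i. norm (c i)) * (\<Sum>i. norm (c i))" for k m
  proof -
    have "norm (\<Sum>i<k. W c i m) \<le> (\<Sum>i<k. exp (\<Sum>i. norm (c i)) * norm (c i))"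
      by (intro sum_norm_le W_le c)
    also have "\<dots> \<le> exp (\<Sum>i. norm (c i)) * (\<Sum>i. norm (c i))"
      unfolding sum_distrib_left[symmetric] using c by (auto intro: sum_le_suminf)
    finally show ?thesis .
  qed

  \<comment> \<open>The divided identity, still exact for each \<open>m\<close>; cancelling uses
    that \<open>t m\<close> is nonzero.\<close>
  have key: "(\<Sum>k. A k * (\<Sum>i<k. W c i m)) = C * (\<Sum>i. W d i m)" for m
  proof -
    have "summable (\<lambda>i. W d i m)"
      by (rule summable_comparison_test'[OF summable_mult[OF d] W_le[OF d]])
    then have "(\<lambda>n. \<Sum>i<n. W d i m) \<longlonglongrightarrow> (\<Sum>i. W d i m)"
      by (rule summable_LIMSEQ)
    then have "(\<lambda>n. \<Prod>i<n. 1 - t m * d i) \<longlonglongrightarrow> 1 - t m * (\<Sum>i. W d i m)"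
      unfolding prod by (intro tendsto_intros)
    with P[of m] have P_eq: "P m = 1 - t m * (\<Sum>i. W d i m)"
      by (rule LIMSEQ_unique)
    have "C - C * P m = t m * (C * (\<Sum>i. W d i m))"
      unfolding P_eq by (simp add: algebra_simps)
    moreover have "(\<lambda>k. A k - A k * (\<Prod>i<k. 1 - t m * c i)) sums (C - C * P m)"
      by (intro sums_diff C eq)
    ultimately have "(\<lambda>k. t m * (A k * (\<Sum>i<k. W c i m))) sums (t m * (C * (\<Sum>i. W d i m)))"
      unfolding prod by (simp only: right_diff_distrib mult_1_right diff_diff_eq2 add_diff_cancel_left' mult.left_commute)
    then show ?thesis
      unfolding sums_mult_iff[OF t(2)] by (rule sums_unique[symmetric])
  qed

  let ?M = "\<lambda>k. norm (A k) * (exp (\<Sum>i. norm (c i)) * (\<Sum>i. norm (c i)))"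
  have lim: "(\<lambda>m. A k * (\<Sum>i<k. W c i m)) \<longlonglongrightarrow> A k * (\<Sum>i<k. c i)" for k
    by (intro tendsto_intros W_lim)
  have bd: "norm (A k * (\<Sum>i<k. W c i m)) \<le> ?M k" for k m
    unfolding norm_mult by (intro mult_left_mono W_sum) auto
  note L = tannery_sequence[of "\<lambda>k m. A k * (\<Sum>i<k. W c i m)", OF lim bd summable_mult2[OF A]]
  have "(\<lambda>m. \<Sum>i. W d i m) \<longlonglongrightarrow> (\<Sum>i. d i)"
    by (rule tannery_sequence[OF W_lim W_le[OF d] summable_mult[OF d]])
  then have "(\<lambda>m. C * (\<Sum>i. W d i m)) \<longlonglongrightarrow> C * (\<Sum>i. d i)"
    by (intro tendsto_intros)
  with L(2) have "(\<Sum>k. A k * (\<Sum>i<k. c i)) = C * (\<Sum>i. d i)"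
    unfolding key by (rule LIMSEQ_unique)
  with L(1) show ?thesis by (simp add: sums_iff)
qed

section \<open>The specialisation a = q x, b = q / x and its coefficients\<close>

lemma qpoch_mult_reciprocal:
  assumes "x \<noteq> 0" "\<And>i. p ^ Suc i \<noteq> 1"
  shows "qpoch (p * x) p n * qpoch (p / x) p n
    = (qpoch p p n)\<^sup>2 * (\<Prod>i<n. 1 - (x + 1 / x - 2) * (p ^ Suc i / (1 - p ^ Suc i)\<^sup>2))"
proof -
  have "(1 - p * x * p ^ i) * (1 - p / x * p ^ i)
    = (1 - p * p ^ i)\<^sup>2 * (1 - (x + 1 / x - 2) * (p ^ Suc i / (1 - p ^ Suc i)\<^sup>2))" for i
  proof -
    define r where "r = p * p ^ i"
    have r: "1 - r \<noteq> 0" using assms(2)[of i] by (simp add: r_def)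
    \<comment> \<open>Dividing out the value at x = 1 puts each factor into the form 1 - t c that
      the coefficient comparison expects.\<close>
    have "(1 - r)\<^sup>2 * (1 - (x + 1 / x - 2) * (r / (1 - r)\<^sup>2)) = (1 - r)\<^sup>2 - (x + 1 / x - 2) * r"
      using r by (simp add: right_diff_distrib)
    also have "\<dots> = (1 - r * x) * (1 - r / x)"
      using assms(1) by (simp add: field_simps power2_eq_square)
    finally show ?thesis by (simp add: r_def mult_ac)
  qed
  then show ?thesis
    unfolding qpoch_def power2_eq_square prod.distrib[symmetric] by (simp add: mult_ac)
qed

text \<open>The denominators stay away from 0, since |1 - p^(i+1)| \<ge> 1 - |p|; the numerators are
  geometric.\<close>

lemma summable_norm_lambert_sq:
  fixes p :: complex
  assumes p: "norm p < 1"
  shows "summable (\<lambda>i. norm (p ^ Suc i / (1 - p ^ Suc i)\<^sup>2))"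
proof (rule summable_comparison_test')
  show "summable (\<lambda>i. norm p ^ i / (1 - norm p)\<^sup>2)"
    using p by (intro summable_divide summable_geometric) auto
  show "norm (norm (p ^ Suc i / (1 - p ^ Suc i)\<^sup>2)) \<le> norm p ^ i / (1 - norm p)\<^sup>2" for i
  proof -
    have "norm (p ^ Suc i) \<le> norm p"
      using p by (simp add: norm_mult norm_power mult_left_le power_le_one)
    then have "1 - norm p \<le> norm (1 - p ^ Suc i)"
      using norm_triangle_ineq2[of 1 "p ^ Suc i"] by simp
    then have "(1 - norm p)\<^sup>2 \<le> norm (1 - p ^ Suc i) ^ 2"
      using p by (intro power_mono) auto
    moreover have "norm p ^ Suc i \<le> norm p ^ i"
      using p by (intro power_decreasing) auto
    ultimately show ?thesis
      using p by (auto simp: norm_divide norm_power norm_mult intro!: frac_le)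
  qed
qed

text \<open>The case i = 0 is included: both sides are then 0 because division by 0 gives 0.\<close>

lemma power_div_qint_sq:
  assumes "norm q < 1"
  shows "q ^ i / (qint q i)\<^sup>2 = (1 - q)\<^sup>2 * (q ^ i / (1 - q ^ i)\<^sup>2)"
proof -
  have "q \<noteq> 1" using assms by auto
  then have "qint q i = (1 - q ^ i) / (1 - q)"
    by (simp add: qint_def sum_gp_strict)
  then show ?thesis by (simp add: power_divide)
qed

text \<open>Summability of the right-hand series is asserted separately, so that its
  \<open>suminf\<close> is a genuine sum; \<open>sums\<close> already contains convergence on the
  left.\<close>

theorem theorem1p4:
  fixes q :: complex
  assumes "norm q < 1"
  shows "summable (\<lambda>j. q ^ (2 * Suc j) / (qint q (2 * Suc j))\<^sup>2) \<and>
    (\<lambda>k. q ^ (Suc k choose 2) * (qpoch q q k / qpoch (q ^ 3) (q ^ 2) k)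
          * (\<Sum>i=1..k. q ^ i / (qint q i)\<^sup>2))
    sums
    ((qpoch_inf (q ^ 2) (q ^ 2))\<^sup>2 / (qpoch_inf q (q ^ 2) * qpoch_inf (q ^ 3) (q ^ 2))
      * (\<Sum>j. q ^ (2 * Suc j) / (qint q (2 * Suc j))\<^sup>2))"
proof -
  note q = assms
  note q2 = norm_power_sq_less_one[OF q]
  define c where "c p i = p ^ Suc i / (1 - p ^ Suc i)\<^sup>2" for p :: complex and i
  define A where "A k = q ^ (Suc k choose 2) * (qpoch q q k / qpoch (q ^ 3) (q ^ 2) k)" for k
  define C where "C = (qpoch_inf (q ^ 2) (q ^ 2))\<^sup>2 / (qpoch_inf q (q ^ 2) * qpoch_inf (q ^ 3) (q ^ 2))"
  \<comment> \<open>Any sequence tending to 1 and avoiding 0 and 1 would suit; this one gives t = 1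
    / ((m+1)(m+2)), visibly nonzero and tending to 0.\<close>
  define x :: "nat \<Rightarrow> complex" where "x m = of_nat (Suc (Suc m)) / of_nat (Suc m)" for m
  define t where "t m = x m + 1 / x m - 2" for m
  define P where "P m = qpoch_inf (q ^ 2 * x m) (q ^ 2) * qpoch_inf (q ^ 2 / x m) (q ^ 2)
    / (qpoch_inf (q ^ 2) (q ^ 2))\<^sup>2" for m

  have q_pow: "q ^ Suc i \<noteq> 1" for i
    using power_ne_one[OF q, of "Suc i"] by simp
  have q2_pow: "(q ^ 2) ^ Suc i \<noteq> 1" for i
    using power_ne_one[OF q2, of "Suc i"] by simp
  have q3: "q ^ 3 * (q ^ 2) ^ i \<noteq> 1" for i
    using power_ne_one[OF q, of "3 + 2 * i"] by (simp add: power_add power_mult)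
  have qq: "qpoch q q k \<noteq> 0" for k
    using q_pow by (intro qpoch_nonzero) simp
  have q22: "qpoch (q ^ 2) (q ^ 2) n \<noteq> 0" "qpoch_inf (q ^ 2) (q ^ 2) \<noteq> 0" for n
    using q2_pow by (auto intro!: qpoch_nonzero qpoch_inf_nonzero[OF q2] simp del: power_Suc simp flip: power_Suc)

  \<comment> \<open>With a = qy and b = q/y the product abq = q^3 is independent of
    \<open>y\<close>. One factor (q;q)_k of the square cancels against the denominator, leaving
    \<open>A k\<close>.\<close>
  have gauss: "(\<lambda>k. A k * (\<Prod>i<k. 1 - (y + 1 / y - 2) * c q i)) sums
      (qpoch_inf (q ^ 2 * y) (q ^ 2) * qpoch_inf (q ^ 2 / y) (q ^ 2)
        / (qpoch_inf q (q ^ 2) * qpoch_inf (q ^ 3) (q ^ 2)))" if y: "y \<noteq> 0" for y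
  proof -
    have ab: "q * y * (q / y) * q = q ^ 3"
      using y by (simp add: power3_eq_cube)
    have "q * y * (q / y) * q * (q ^ 2) ^ i \<noteq> 1" for i
      unfolding ab by (rule q3)
    from q_gauss2[OF q this] have "gauss2_term q (q * y) (q / y) sums
      (qpoch_inf (q ^ 2 * y) (q ^ 2) * qpoch_inf (q ^ 2 / y) (q ^ 2)
        / (qpoch_inf q (q ^ 2) * qpoch_inf (q ^ 3) (q ^ 2)))"
      unfolding ab by (simp add: power2_eq_square mult_ac)
    moreover have "gauss2_term q (q * y) (q / y) = (\<lambda>k. A k * (\<Prod>i<k. 1 - (y + 1 / y - 2) * c q i))"
      unfolding gauss2_term_def ab qpoch_mult_reciprocal[OF y q_pow] A_def c_def
      using qq by (simp add: power2_eq_square mult_ac)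
    ultimately show ?thesis by simp
  qed

  have x_nz: "x m \<noteq> 0" for m
    unfolding x_def by (simp del: of_nat_Suc)
  have t_eq: "t m = 1 / (of_nat (Suc m) * of_nat (Suc (Suc m)))" for m
  proof -
    define y where "y = (of_nat (Suc m) :: complex)"
    have "y \<noteq> 0" "y + 1 \<noteq> 0" "of_nat (Suc (Suc m)) = y + 1"
      using of_nat_neq_0[of m, where 'a = complex] of_nat_neq_0[of "Suc m", where 'a = complex]
      by (simp_all add: y_def add_ac)
    then show ?thesis
      unfolding t_def x_def y_def[symmetric] by (simp add: divide_simps) (simp add: algebra_simps)
  qed
  have norm_t: "norm (t m) \<le> inverse (real (Suc m))" for m
    unfolding t_eq by (simp add: norm_divide norm_mult divide_simps del: of_nat_Suc)

  have "(\<lambda>k. A k * (\<Sum>i<k. c q i)) sums (C * (\<Sum>j. c (q ^ 2) j))"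
  proof (rule linear_coefficient_comparison)
    obtain K where K: "K > 0" "\<And>n. norm (inverse (qpoch (q ^ 3) (q ^ 2) n)) \<le> K"
      using norm_inverse_qpoch_bounded[OF q2 q3] by metis
    show "summable (\<lambda>k. norm (A k))"
    proof (rule summable_comparison_test')
      show "summable (\<lambda>k. norm q ^ k * (exp (norm q * inverse (1 - norm q)) * K))"
        using q by (intro summable_mult2 summable_geometric) auto
      show "norm (norm (A k)) \<le> norm q ^ k * (exp (norm q * inverse (1 - norm q)) * K)" for k
        unfolding A_def divide_inverse norm_mult real_norm_def abs_mult abs_norm_cancel
        by (intro mult_mono norm_power_triangular_le norm_qpoch_le[unfolded divide_inverse] q K) (use K in auto)
    qed
    show "summable (\<lambda>i. norm (c q i))" "summable (\<lambda>i. norm (c (q ^ 2) i))"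
      unfolding c_def by (intro summable_norm_lambert_sq q q2)+
    show "t \<longlonglongrightarrow> 0"
      by (rule Lim_null_comparison[OF _ LIMSEQ_inverse_real_of_nat])
        (use norm_t in \<open>auto intro: always_eventually\<close>)
    show "t m \<noteq> 0" for m
      unfolding t_eq by (simp del: of_nat_Suc)
    show "norm (t m) \<le> 1" for m
      using norm_t[of m] by (rule order_trans) (simp add: divide_simps)
    \<comment> \<open>At y = 1 the parameter t is 0 and all factors of the finite product are
      1.\<close>
    show "A sums C"
      using gauss[of 1] by (simp add: C_def power2_eq_square)
    show "(\<lambda>n. \<Prod>i<n. 1 - t m * c (q ^ 2) i) \<longlonglongrightarrow> P m" for m
    proof -
      have "(\<lambda>n. qpoch (q ^ 2 * x m) (q ^ 2) n * qpoch (q ^ 2 / x m) (q ^ 2) n / (qpoch (q ^ 2) (q ^ 2) n)\<^sup>2)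
          \<longlonglongrightarrow> P m"
        unfolding P_def by (intro tendsto_intros qpoch_LIMSEQ q2) (use q22 in auto)
      then show ?thesis
        unfolding qpoch_mult_reciprocal[OF x_nz q2_pow] c_def t_def using q22 by simp
    qed
    show "(\<lambda>k. A k * (\<Prod>i<k. 1 - t m * c q i)) sums (C * P m)" for m
      using gauss[OF x_nz[of m]] q22 by (simp add: C_def P_def t_def)
  qed
  \<comment> \<open>The factor (1 - q)^2 converts the denominators (1 - q^i)^2 into squares of
    q-integers.\<close>
  then have "(\<lambda>k. (1 - q)\<^sup>2 * (A k * (\<Sum>i<k. c q i))) sums ((1 - q)\<^sup>2 * (C * (\<Sum>j. c (q ^ 2) j)))"
    by (rule sums_mult)
  also have "(\<lambda>k. (1 - q)\<^sup>2 * (A k * (\<Sum>i<k. c q i))) = (\<lambda>k. A k * (\<Sum>i=1..k. q ^ i / (qint q i)\<^sup>2))"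
  proof
    fix k
    have "(\<Sum>i=1..k. q ^ i / (qint q i)\<^sup>2) = (\<Sum>i<k. (1 - q)\<^sup>2 * c q i)"
      unfolding power_div_qint_sq[OF q] c_def
      by (rule sum.reindex_bij_witness[of _ Suc "\<lambda>i. i - 1"]) auto
    then show "(1 - q)\<^sup>2 * (A k * (\<Sum>i<k. c q i)) = A k * (\<Sum>i=1..k. q ^ i / (qint q i)\<^sup>2)"
      by (simp only: sum_distrib_left[symmetric] mult.left_commute)
  qed
  finally have sums: "(\<lambda>k. A k * (\<Sum>i=1..k. q ^ i / (qint q i)\<^sup>2)) sums ((1 - q)\<^sup>2 * (C * (\<Sum>j. c (q ^ 2) j)))" .
  \<comment> \<open>Base q^2 on the product side is the source of the even indices; the q-integers
    remain in base \<open>q\<close>, so the same factor (1 - q)^2 fits.\<close>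
  have even: "q ^ (2 * Suc j) / (qint q (2 * Suc j))\<^sup>2 = (1 - q)\<^sup>2 * c (q ^ 2) j" for j
    unfolding power_div_qint_sq[OF q] c_def power_mult[symmetric] ..
  have c_summable: "summable (c (q ^ 2))"
    unfolding c_def [abs_def] by (rule summable_norm_cancel[OF summable_norm_lambert_sq[OF q2]])
  have "(1 - q)\<^sup>2 * (C * (\<Sum>j. c (q ^ 2) j)) = C * (\<Sum>j. (1 - q)\<^sup>2 * c (q ^ 2) j)"
    unfolding suminf_mult[OF c_summable] by (rule mult.left_commute)
  with sums show ?thesis
    unfolding even A_def C_def by (intro conjI summable_mult c_summable) (simp only:)
qed

end
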